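(* Let $f:\mathcal{H}\to\mathbb{R}$ be $L$-smooth, convex, and $\mu$-gradient dominated. Run the Boosted Frank-Wolfe algorithm (BoostFW) on $\min_{x\in\mathcal{C}}f(x)$ with $\gamma_t\leftarrow\min\{\eta_t\|\nabla f(x_t)\|/(L\|g_t\|),1\}$ or $\gamma_t\leftarrow\arg\min_{\gamma\in[0,1]}f(x_t+\gamma g_t)$, where $\eta_t:=\operatorname{align}(-\nabla f(x_t),g_t)$. Assume that for some $\omega>0$ and $p\in(0,1]$, $|\{s\in\{0,\ldots,t-1\}\mid\gamma_s<1,\ K_s>1\}|\geq\omega t^p$ for all $t\in\{0,\ldots,T\}$. Then for all $t\in\{0,\ldots,T\}$, $$f(x_t)-\min_{\mathcal{C}}f\leq\frac{LD^2}{2}\exp\left(-\delta^2\frac{\mu}{L}\omega t^p\right).$$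
   Context: $(\mathcal{H},\langle\cdot,\cdot\rangle)$ is a Euclidean space with induced norm $\|\cdot\|$, and $\mathcal{C}\subset\mathcal{H}$ is a nonempty compact convex set with diameter $D:=\max_{x,y\in\mathcal{C}}\|y-x\|$. If $\mathcal{C}$ is a polytope, $\mathcal{V}$ is its set of vertices; otherwise $\mathcal{V}:=\partial\mathcal{C}$ (the boundary). A differentiable $f:\mathcal{H}\to\mathbb{R}$ is $L$-smooth ($L>0$) if $f(y)-f(x)-\langle\nabla f(x),y-x\rangle\leq\frac{L}{2}\|y-x\|^2$ for all $x,y\in\mathcal{H}$; it is $\mu$-gradient dominated ($\mu>0$) if $\arg\min_{\mathcal{H}}f\neq\varnothing$ and $f(x)-\min_{\mathcal{H}}f\leq\|\nabla f(x)\|^2/(2\mu)$ for all $x\in\mathcal{H}$. For $d\in\mathcal{H}\setminus\{0\}$ and $\hat d\in\mathcal{H}$, $\operatorname{align}(d,\hat d):=\langle d,\hat d\rangle/(\|d\|\|\hat d\|)$ if $\hat d\neq0$, and $\operatorname{align}(d,\hat d):=-1$ if $\hat d=0$. BoostFW. Input: a point $y\in\mathcal{C}$, a maximum number of rounds $K\in\mathbb{N}\setminus\{0\}$, a tolerance $\delta\in(0,1)$, a number of iterations $T$, and a step-size strategy $\gamma_t\in[0,1]$. Set $x_0\in\arg\min_{v\in\mathcal{V}}\langle\nabla f(y),v\rangle$. For $t=0,\ldots,T-1$: (1) Set $d_0=0$, $\Lambda_t=0$. (2) For $k=0,1,\ldots,K-1$: let $r_k=-\nabla f(x_t)-d_k$;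 choose $v_k\in\arg\max_{v\in\mathcal{V}}\langle r_k,v\rangle$; choose $u_k\in\arg\max\{\langle r_k,u\rangle: u\in\{v_k-x_t,\,-d_k/\|d_k\|\}\}$ (with $u_k=v_k-x_t$ when $d_k=0$); let $\lambda_k=\langle r_k,u_k\rangle/\|u_k\|^2$ (with $\lambda_k=0$ if $u_k=0$) and $d_k'=d_k+\lambda_ku_k$. If $\operatorname{align}(-\nabla f(x_t),d_k')-\operatorname{align}(-\nabla f(x_t),d_k)\geq\delta$, then set $d_{k+1}=d_k'$ and update $\Lambda_t\leftarrow\Lambda_t+\lambda_k$ if $u_k=v_k-x_t$, or $\Lambda_t\leftarrow\Lambda_t(1-\lambda_k/\|d_k\|)$ if $u_k=-d_k/\|d_k\|$. Otherwise exit the loop over $k$. (3) Let $K_t$ be the value of $k$ at which the loop was exited early, or $K_t=K$ if it was not exited early. Set $g_t=d_{K_t}/\Lambda_t$ and $x_{t+1}=x_t+\gamma_tg_t$. (The quantities $d_k,r_k,v_k,u_k,\lambda_k$ depend on $t$. Ties in argmin/argmax are broken arbitrarily.) It is understood that no $x_t$ with $t\leq T-1$ is a minimizer of $f$ over $\mathcal{C}$, so that all steps are well defined. *)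

theory Defs
  imports "HOL-Analysis.Analysis"
begin

definition grad :: "('a::real_inner \<Rightarrow> real) \<Rightarrow> 'a \<Rightarrow> 'a" where
  "grad f x = (THE D. GDERIV f x :> D)"

lemma grad_eqI:
  assumes "GDERIV f x :> D"
  shows "grad f x = D"
  unfolding grad_def
proof (rule the_equality[where P = "\<lambda>D. GDERIV f x :> D", OF assms])
  fix E assume "GDERIV f x :> E"
  then have "(\<lambda>h. h \<bullet> E) = (\<lambda>h. h \<bullet> D)"
    using assms unfolding gderiv_def by (rule has_derivative_unique)
  then have "(E - D) \<bullet> (E - D) = 0"
    by (metis inner_diff_right right_minus_eq)
  then show "E = D" by simp
qed

definition smooth_fun :: "real \<Rightarrow> ('a::real_inner \<Rightarrow> real) \<Rightarrow> bool" where
  "smooth_fun L f \<longleftrightarrow>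
     0 < L \<and> (\<forall>x. f differentiable (at x)) \<and>
     (\<forall>x y. f y - f x - grad f x \<bullet> (y - x) \<le> L / 2 * (norm (y - x))\<^sup>2)"

text \<open>The infimum below is the minimum of \<open>f\<close>, since a minimizer is required to exist.\<close>

definition gradient_dominated :: "real \<Rightarrow> ('a::real_inner \<Rightarrow> real) \<Rightarrow> bool" where
  "gradient_dominated \<mu> f \<longleftrightarrow>
     0 < \<mu> \<and> (\<exists>z. is_arg_min f (\<lambda>_. True) z) \<and>
     (\<forall>x. f x - (INF z. f z) \<le> (norm (grad f x))\<^sup>2 / (2 * \<mu>))"

definition align :: "'a::real_inner \<Rightarrow> 'a \<Rightarrow> real" where
  "align d e = (if e = 0 then - 1 else d \<bullet> e / (norm d * norm e))"

text \<open>The set over which the linear subproblems are solved: the vertices of a polytope, and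
  the topological boundary of any other set.\<close>

definition vertex_set :: "'a::euclidean_space set \<Rightarrow> 'a set" where
  "vertex_set C = (if polytope C then {v. v extreme_point_of C} else frontier C)"

text \<open>In the following, \<open>x\<close> is the current iterate, \<open>G\<close> is the negative gradient at \<open>x\<close>, and
  \<open>d\<close> is the current approximation of \<open>G\<close>. Ties are broken arbitrarily, so that the choices
  of \<open>v\<close> and \<open>u\<close> are expressed by a relation.\<close>

definition boost_choice :: "'a::real_inner set \<Rightarrow> 'a \<Rightarrow> 'a \<Rightarrow> 'a \<Rightarrow> 'a \<Rightarrow> 'a \<Rightarrow> bool" where
  "boost_choice V x G d v u \<longleftrightarrow>
     is_arg_max (\<lambda>w. (G - d) \<bullet> w) (\<lambda>w. w \<in> V) v \<and>
     (if d = 0 then u = v - x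
      else is_arg_max (\<lambda>w. (G - d) \<bullet> w) (\<lambda>w. w \<in> {v - x, - d /\<^sub>R norm d}) u)"

definition boost_coeff :: "'a::real_inner \<Rightarrow> 'a \<Rightarrow> 'a \<Rightarrow> real" where
  "boost_coeff G d u = (if u = 0 then 0 else (G - d) \<bullet> u / (norm u)\<^sup>2)"

text \<open>\<open>boost_loop V K \<delta> x G d \<Lambda> n\<close>: starting at \<open>x\<close>, the inner loop accepts exactly
  the rounds \<open>0, \<dots>, n - 1\<close>. It then either is exited early in round \<open>n < K\<close>, or \<open>n = K\<close>.
  The value of the accumulated weight after \<open>k\<close> accepted rounds is \<open>\<Lambda> k\<close>, and
  only \<open>d 0, \<dots>, d n\<close> and \<open>\<Lambda> 0, \<dots>, \<Lambda> n\<close> are meaningful.\<close>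

definition boost_loop ::
  "'a::real_inner set \<Rightarrow> nat \<Rightarrow> real \<Rightarrow> 'a \<Rightarrow> 'a \<Rightarrow> (nat \<Rightarrow> 'a) \<Rightarrow> (nat \<Rightarrow> real) \<Rightarrow> nat \<Rightarrow> bool" where
  "boost_loop V K \<delta> x G d \<Lambda> n \<longleftrightarrow>
     d 0 = 0 \<and> \<Lambda> 0 = 0 \<and> n \<le> K \<and>
     (\<forall>k<n. \<exists>v u. boost_choice V x G (d k) v u \<and>
        (let l = boost_coeff G (d k) u; d' = d k + l *\<^sub>R u in
           align G d' - align G (d k) \<ge> \<delta> \<and>
           d (Suc k) = d' \<and>
           \<Lambda> (Suc k) = (if u = v - x then \<Lambda> k + l else \<Lambda> k * (1 - l / norm (d k))))) \<and>
     (n < K \<longrightarrow> (\<exists>v u. boost_choice V x G (d n) v u \<and>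
        (let d' = d n + boost_coeff G (d n) u *\<^sub>R u in
           \<not> align G d' - align G (d n) \<ge> \<delta>)))"

text \<open>A run of the algorithm for \<open>T\<close> iterations, with iterates \<open>x t\<close>, step directions \<open>g t\<close>,
  numbers of rounds \<open>R t\<close>, and step sizes \<open>\<gamma> t\<close>.\<close>

definition boostfw_run ::
  "('a::euclidean_space \<Rightarrow> real) \<Rightarrow> 'a set \<Rightarrow> 'a \<Rightarrow> nat \<Rightarrow> real \<Rightarrow> nat \<Rightarrow>
   (nat \<Rightarrow> real) \<Rightarrow> (nat \<Rightarrow> 'a) \<Rightarrow> (nat \<Rightarrow> 'a) \<Rightarrow> (nat \<Rightarrow> nat) \<Rightarrow> bool" where
  "boostfw_run f C y K \<delta> T \<gamma> x g R \<longleftrightarrow>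
     is_arg_min (\<lambda>v. grad f y \<bullet> v) (\<lambda>v. v \<in> vertex_set C) (x 0) \<and>
     (\<forall>t<T. 0 \<le> \<gamma> t \<and> \<gamma> t \<le> 1 \<and>
        (\<exists>d \<Lambda>. boost_loop (vertex_set C) K \<delta> (x t) (- grad f (x t)) d \<Lambda> (R t) \<and>
           g t = d (R t) /\<^sub>R \<Lambda> (R t)) \<and>
        x (Suc t) = x t + \<gamma> t *\<^sub>R g t)"

definition short_step ::
  "real \<Rightarrow> ('a::real_inner \<Rightarrow> real) \<Rightarrow> 'a \<Rightarrow> 'a \<Rightarrow> real \<Rightarrow> bool" where
  "short_step L f x g \<gamma> \<longleftrightarrow>
     \<gamma> = min (align (- grad f x) g * norm (grad f x) / (L * norm g)) 1"

definition line_search_step ::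
  "('a::real_inner \<Rightarrow> real) \<Rightarrow> 'a \<Rightarrow> 'a \<Rightarrow> real \<Rightarrow> bool" where
  "line_search_step f x g \<gamma> \<longleftrightarrow> is_arg_min (\<lambda>s. f (x + s *\<^sub>R g)) (\<lambda>s. s \<in> {0..1}) \<gamma>"

end

theory Submission imports Defs begin

text \<open>
  Why the theorem holds. Two facts about a single outer iteration carry the proof. First, the
  inner loop never leaves the cone spanned by \<open>C - x\<close>: each accepted \<open>d\<close> is \<open>\<Lambda> *\<^sub>R (z - x)\<close>
  for some \<open>z \<in> C\<close> with \<open>\<Lambda> > 0\<close>, so the step direction \<open>g\<close> is a positive multiple of \<open>d\<close> and
  \<open>x + g \<in> C\<close>. Every accepted round gains at least \<open>\<delta>\<close> in alignment with the negative gradient, and the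
  first round already has positive alignment; hence two or more rounds give
  \<open>\<eta> = align (- grad f x) g \<ge> \<delta>\<close> (\<open>boost_loop_invariant\<close>).

  Second, an uncapped step (\<open>\<gamma> < 1\<close>) with \<open>\<eta> \<ge> 0\<close> makes at least the progress
  \<open>\<eta>\<^sup>2 \<parallel>grad f x\<parallel>\<^sup>2 / (2 L)\<close> which smoothness guarantees for the step size
  \<open>\<eta> \<parallel>grad f x\<parallel> / (L \<parallel>g\<parallel>)\<close>. For line search this uses convexity: a minimizer over
  \<open>[0, 1]\<close> that is different from \<open>1\<close> minimizes over the whole half-line \<open>[0, \<infinity>)\<close>
  (\<open>uncapped_step_progress\<close>). Gradient
  domination bounds \<open>\<parallel>grad f x\<parallel>\<^sup>2\<close> from below by \<open>2 \<mu>\<close> times the gap, so each iteration with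
  \<open>\<gamma> < 1\<close> and at least two rounds multiplies the gap by at most \<open>1 - \<delta>\<^sup>2 \<mu> / L\<close>,
  hence by at most \<open>exp (- \<delta>\<^sup>2 \<mu> / L)\<close>; all other iterations do not increase it. At the start the
  gap is at most \<open>L D\<^sup>2 / 2\<close>, because \<open>x 0\<close> minimizes the linearization of \<open>f\<close> at \<open>y\<close> over \<open>C\<close>.
\<close>

section \<open>Gradients of convex functions\<close>

lemma GDERIV_grad:
  fixes f :: "'a::euclidean_space \<Rightarrow> real"
  assumes "f differentiable (at x)"
  shows "GDERIV f x :> grad f x"
proof -
  obtain f' where f': "(f has_derivative f') (at x)"
    using assms unfolding differentiable_def by blast
  then have lin: "linear f'" by (rule has_derivative_linear)
  have "f' h = h \<bullet> adjoint f' 1" for h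
    using adjoint_works[OF lin, of h 1] by simp
  then have "f' = (\<lambda>h. h \<bullet> adjoint f' 1)" by blast
  with f' have "GDERIV f x :> adjoint f' 1" unfolding gderiv_def by simp
  then show ?thesis using grad_eqI by metis
qed

lemma convex_above_grad_tangent:
  fixes f :: "'a::euclidean_space \<Rightarrow> real"
  assumes cvx: "convex_on UNIV f" and diff: "f differentiable (at y)"
  shows "f y + grad f y \<bullet> (z - y) \<le> f z"
proof -
  define h where "h = (\<lambda>s. f (y + s *\<^sub>R (z - y)))"
  have "convex_on UNIV h"
  proof (rule convex_onI)
    fix t a b :: real assume t: "0 < t" "t < 1"
    have "y + ((1 - t) *\<^sub>R a + t *\<^sub>R b) *\<^sub>R (z - y)
        = (1 - t) *\<^sub>R (y + a *\<^sub>R (z - y)) + t *\<^sub>R (y + b *\<^sub>R (z - y))"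
      by (simp add: algebra_simps)
    moreover have "f ((1 - t) *\<^sub>R (y + a *\<^sub>R (z - y)) + t *\<^sub>R (y + b *\<^sub>R (z - y)))
        \<le> (1 - t) * f (y + a *\<^sub>R (z - y)) + t * f (y + b *\<^sub>R (z - y))"
      using t by (intro convex_onD[OF cvx]) auto
    ultimately show "h ((1 - t) *\<^sub>R a + t *\<^sub>R b) \<le> (1 - t) * h a + t * h b"
      unfolding h_def by metis
  qed simp
  moreover have "(h has_field_derivative grad f y \<bullet> (z - y)) (at 0)"
  proof -
    have "(f has_derivative (\<lambda>k. k \<bullet> grad f y)) (at (y + 0 *\<^sub>R (z - y)))"
      using GDERIV_grad[OF diff] by (simp add: gderiv_def)
    moreover have "((\<lambda>s. y + s *\<^sub>R (z - y)) has_derivative (\<lambda>s. s *\<^sub>R (z - y))) (at 0)"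
      by (auto intro!: derivative_eq_intros)
    ultimately have "(h has_derivative (\<lambda>s. (s *\<^sub>R (z - y)) \<bullet> grad f y)) (at 0)"
      unfolding h_def by (rule has_derivative_compose[rotated])
    then show ?thesis
      by (simp add: has_field_derivative_def inner_commute mult.commute[of _ "grad f y \<bullet> (z - y)"])
  qed
  ultimately have "h 1 - h 0 \<ge> (grad f y \<bullet> (z - y)) * (1 - 0)"
    by (intro convex_on_imp_above_tangent[where A = UNIV]) auto
  then show ?thesis by (simp add: h_def)
qed

section \<open>Linear optimization over the vertex set\<close>

lemma vertex_set_subset:
  assumes "compact C"
  shows "vertex_set C \<subseteq> C"
  using assms by (auto simp: vertex_set_def extreme_point_of_def frontier_def closure_closed
      compact_imp_closed)

text \<open>Both cases of the vertex set contain all extreme points of \<open>C\<close>, and by the theorem of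
  Krein, Milman and Minkowski these have \<open>C\<close> as their convex hull.\<close>

lemma arg_max_vertex_set_bounds:
  fixes C :: "'a::euclidean_space set"
  assumes "compact C" "convex C"
    and "is_arg_max (\<lambda>w. c \<bullet> w) (\<lambda>w. w \<in> vertex_set C) v" and "z \<in> C"
  shows "c \<bullet> z \<le> c \<bullet> v"
proof -
  have "w \<in> frontier C" if "w extreme_point_of C" for w
    using that extreme_point_not_in_interior[OF that] closure_subset
    by (auto simp: frontier_def extreme_point_of_def)
  then have ext: "{w. w extreme_point_of C} \<subseteq> vertex_set C"
    by (auto simp: vertex_set_def)
  have "c \<bullet> w \<le> c \<bullet> v" if "w \<in> vertex_set C" for w
    using assms(3) that by (fastforce simp: is_arg_max_def)
  with ext have "{w. w extreme_point_of C} \<subseteq> {w. c \<bullet> w \<le> c \<bullet> v}" by blast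
  then have "convex hull {w. w extreme_point_of C} \<subseteq> {w. c \<bullet> w \<le> c \<bullet> v}"
    by (rule hull_minimal) (rule convex_halfspace_le)
  then show ?thesis using Krein_Milman_Minkowski[OF assms(1,2)] assms(4) by blast
qed

section \<open>The inner loop\<close>

lemma boost_loop_round:
  assumes "boost_loop V K \<delta> x G d \<Lambda> n" and "k < n"
  obtains v u where "boost_choice V x G (d k) v u"
    and "align G (d k + boost_coeff G (d k) u *\<^sub>R u) - align G (d k) \<ge> \<delta>"
    and "d (Suc k) = d k + boost_coeff G (d k) u *\<^sub>R u"
    and "\<Lambda> (Suc k) = (if u = v - x then \<Lambda> k + boost_coeff G (d k) u
          else \<Lambda> k * (1 - boost_coeff G (d k) u / norm (d k)))"
  using assms unfolding boost_loop_def Let_def by blast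

lemma align_scaleR_right:
  assumes "0 < c"
  shows "align G (c *\<^sub>R d) = align G d"
  using assms by (simp add: align_def)

lemma align_pos_iff: "0 < align G d \<longleftrightarrow> 0 < G \<bullet> d"
proof (cases "G = 0 \<or> d = 0")
  case False
  then show ?thesis by (simp add: align_def zero_less_divide_iff zero_less_mult_iff mult_less_0_iff)
qed (auto simp: align_def)

text \<open>With \<open>d = 0\<close> the first round projects \<open>G\<close> onto a line, so its inner product with \<open>G\<close>
  is a square. The threshold \<open>\<delta>\<close> excludes the projection \<open>0\<close>, whose alignment is still \<open>-1\<close>.\<close>

lemma first_round_inner_pos:
  assumes "0 < \<delta>" and "align G (boost_coeff G 0 u *\<^sub>R u) - align G 0 \<ge> \<delta>"
  shows "0 < boost_coeff G 0 u * (G \<bullet> u)"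
proof -
  have "boost_coeff G 0 u *\<^sub>R u \<noteq> 0" using assms by (auto simp: align_def split: if_splits)
  then show ?thesis
    by (auto simp: boost_coeff_def zero_less_mult_iff zero_less_divide_iff divide_less_0_iff
        split: if_splits)
qed

text \<open>This is why \<open>\<Lambda>\<close> is the right normalization of \<open>d\<close>: the point \<open>w\<close> is the average of \<open>z\<close>
  and \<open>v\<close> with weights proportional to \<open>a\<close> and \<open>b\<close>.\<close>

lemma cone_of_convex_add:
  fixes x :: "'a::real_vector"
  assumes "convex C" "z \<in> C" "v \<in> C" "0 \<le> a" "0 \<le> b" "0 < a + b"
  shows "\<exists>w\<in>C. a *\<^sub>R (z - x) + b *\<^sub>R (v - x) = (a + b) *\<^sub>R (w - x)"
proof
  let ?w = "(a / (a + b)) *\<^sub>R z + (b / (a + b)) *\<^sub>R v"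
  show "?w \<in> C"
    using assms by (intro convexD) (auto simp: add_divide_distrib[symmetric])
  have "(a + b) *\<^sub>R ?w = a *\<^sub>R z + b *\<^sub>R v"
    using assms by (simp add: scaleR_add_right)
  then show "a *\<^sub>R (z - x) + b *\<^sub>R (v - x) = (a + b) *\<^sub>R (?w - x)"
    by (simp add: scaleR_diff_right scaleR_add_left)
qed

text \<open>The weight \<open>\<Lambda>\<close> stays positive for two different reasons. A Frank-Wolfe direction \<open>v - x\<close>
  has a nonnegative coefficient, since \<open>x \<in> C\<close> competes with \<open>v\<close> in the linear subproblem.
  The direction \<open>- d /\<^sub>R norm d\<close> rescales \<open>d\<close> and \<open>\<Lambda>\<close> by the same factor
  \<open>G \<bullet> d / (norm d)\<^sup>2\<close>, which is positive because alignment is positive from the first round on.\<close>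

lemma boost_loop_invariant:
  assumes "convex C" "V \<subseteq> C" "x \<in> C"
    and opt: "\<And>c v z. is_arg_max (\<lambda>w. c \<bullet> w) (\<lambda>w. w \<in> V) v \<Longrightarrow> z \<in> C \<Longrightarrow> c \<bullet> z \<le> c \<bullet> v"
    and \<delta>: "0 < \<delta>"
    and loop: "boost_loop V K \<delta> x G d \<Lambda> n"
    and "Suc k \<le> n"
  shows "0 < \<Lambda> (Suc k) \<and> (\<exists>z\<in>C. d (Suc k) = \<Lambda> (Suc k) *\<^sub>R (z - x)) \<and>
    0 < align G (d (Suc k)) \<and> real k * \<delta> \<le> align G (d (Suc k))"
  using \<open>Suc k \<le> n\<close>
proof (induction k)
  case 0
  then obtain v u where ch: "boost_choice V x G (d 0) v u"
    and al: "align G (d 0 + boost_coeff G (d 0) u *\<^sub>R u) - align G (d 0) \<ge> \<delta>"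
    and d: "d (Suc 0) = d 0 + boost_coeff G (d 0) u *\<^sub>R u"
    and l: "\<Lambda> (Suc 0) = (if u = v - x then \<Lambda> 0 + boost_coeff G (d 0) u
          else \<Lambda> 0 * (1 - boost_coeff G (d 0) u / norm (d 0)))"
    using boost_loop_round[OF loop, of 0] by auto
  have z: "d 0 = 0" "\<Lambda> 0 = 0" using loop by (auto simp: boost_loop_def)
  have u: "u = v - x" and v: "is_arg_max (\<lambda>w. G \<bullet> w) (\<lambda>w. w \<in> V) v"
    using ch z by (auto simp: boost_choice_def)
  have pos: "0 < boost_coeff G 0 u * (G \<bullet> u)"
    using first_round_inner_pos[OF \<delta>] al z by simp
  have "0 \<le> G \<bullet> u" using opt[OF v \<open>x \<in> C\<close>] u by (simp add: inner_diff_right)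
  with pos have "0 < boost_coeff G 0 u" by (simp add: zero_less_mult_iff)
  moreover have "v \<in> C" using v \<open>V \<subseteq> C\<close> by (auto simp: is_arg_max_def)
  moreover have "0 < align G (d (Suc 0))"
    using pos d z by (simp add: align_pos_iff)
  ultimately show ?case using u d l z by auto
next
  case (Suc k)
  let ?d = "d (Suc k)" and ?\<Lambda> = "\<Lambda> (Suc k)"
  from Suc obtain z where L: "0 < ?\<Lambda>" and z: "z \<in> C" "?d = ?\<Lambda> *\<^sub>R (z - x)"
    and a: "0 < align G ?d" "real k * \<delta> \<le> align G ?d" by auto
  have d0: "?d \<noteq> 0" using a by (auto simp: align_def)
  have "Suc k < n" using Suc.prems by simp
  then obtain v u where ch: "boost_choice V x G ?d v u"
    and al: "align G (?d + boost_coeff G ?d u *\<^sub>R u) - align G ?d \<ge> \<delta>"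
    and d: "d (Suc (Suc k)) = ?d + boost_coeff G ?d u *\<^sub>R u"
    and l: "\<Lambda> (Suc (Suc k)) = (if u = v - x then ?\<Lambda> + boost_coeff G ?d u
          else ?\<Lambda> * (1 - boost_coeff G ?d u / norm ?d))"
    by (rule boost_loop_round[OF loop])
  have v: "is_arg_max (\<lambda>w. (G - ?d) \<bullet> w) (\<lambda>w. w \<in> V) v"
    and uc: "u = v - x \<or> u = - ?d /\<^sub>R norm ?d"
    using ch d0 by (auto simp: boost_choice_def is_arg_max_def)
  have "real (Suc k) * \<delta> \<le> align G (d (Suc (Suc k)))"
    using al a d by (simp add: algebra_simps)
  moreover from al a \<delta> d have "0 < align G (d (Suc (Suc k)))" by simp
  moreover have "0 < \<Lambda> (Suc (Suc k)) \<and> (\<exists>z\<in>C. d (Suc (Suc k)) = \<Lambda> (Suc (Suc k)) *\<^sub>R (z - x))"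
  proof (cases "u = v - x")
    case True
    have "0 \<le> (G - ?d) \<bullet> u" using opt[OF v \<open>x \<in> C\<close>] True by (simp add: inner_diff_right)
    then have c: "0 \<le> boost_coeff G ?d u" by (simp add: boost_coeff_def)
    have "v \<in> C" using v \<open>V \<subseteq> C\<close> by (auto simp: is_arg_max_def)
    from cone_of_convex_add[OF \<open>convex C\<close> z(1) this, of ?\<Lambda> "boost_coeff G ?d u" x]
    show ?thesis using True d l z(2) L c by auto
  next
    case False
    let ?c = "1 - boost_coeff G ?d u / norm ?d"
    have u: "u = - ?d /\<^sub>R norm ?d" using uc False by blast
    have "boost_coeff G ?d u = (G - ?d) \<bullet> u" using d0 u by (simp add: boost_coeff_def)
    also have "\<dots> = - (G \<bullet> ?d - ?d \<bullet> ?d) / norm ?d"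
      by (simp add: u inner_diff_left divide_simps)
    finally have coeff: "boost_coeff G ?d u = - (G \<bullet> ?d - ?d \<bullet> ?d) / norm ?d" .
    have "?c = G \<bullet> ?d / (?d \<bullet> ?d)"
      unfolding coeff using d0 by (simp add: dot_square_norm power2_eq_square divide_simps)
    then have c: "0 < ?c" using a(1) d0 by (simp add: align_pos_iff)
    have "d (Suc (Suc k)) = ?c *\<^sub>R ?d"
      unfolding d using u by (simp add: scaleR_diff_left divide_inverse)
    also have "\<dots> = \<Lambda> (Suc (Suc k)) *\<^sub>R (z - x)"
      using l False z(2) by (metis mult.commute scaleR_scaleR)
    finally show ?thesis using l False c L z(1) by auto
  qed
  ultimately show ?case by blast
qed

lemma boost_loop_feasible:
  assumes "convex C" "V \<subseteq> C" "x \<in> C"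
    and "\<And>c v z. is_arg_max (\<lambda>w. c \<bullet> w) (\<lambda>w. w \<in> V) v \<Longrightarrow> z \<in> C \<Longrightarrow> c \<bullet> z \<le> c \<bullet> v"
    and "0 < \<delta>" and loop: "boost_loop V K \<delta> x G d \<Lambda> n"
  shows "x + d n /\<^sub>R \<Lambda> n \<in> C"
proof (cases n)
  case 0
  then show ?thesis using loop \<open>x \<in> C\<close> by (simp add: boost_loop_def)
next
  case (Suc k)
  with boost_loop_invariant[OF assms, of k] obtain z
    where "z \<in> C" "0 < \<Lambda> n" "d n = \<Lambda> n *\<^sub>R (z - x)" by auto
  then show ?thesis by simp
qed

lemma boost_loop_align:
  assumes "convex C" "V \<subseteq> C" "x \<in> C"
    and "\<And>c v z. is_arg_max (\<lambda>w. c \<bullet> w) (\<lambda>w. w \<in> V) v \<Longrightarrow> z \<in> C \<Longrightarrow> c \<bullet> z \<le> c \<bullet> v"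
    and \<delta>: "0 < \<delta>" and loop: "boost_loop V K \<delta> x G d \<Lambda> n" and "1 < n"
  shows "\<delta> \<le> align G (d n /\<^sub>R \<Lambda> n)"
proof -
  obtain k where k: "n = Suc k" "1 \<le> k" using \<open>1 < n\<close> by (cases n) auto
  with boost_loop_invariant[OF assms(1-6), of k]
  have "0 < \<Lambda> n" "real k * \<delta> \<le> align G (d n)" by auto
  moreover have "1 * \<delta> \<le> real k * \<delta>" using k \<delta> by (intro mult_right_mono) auto
  ultimately show ?thesis by (simp add: align_scaleR_right)
qed

section \<open>Progress of one step\<close>

lemma smooth_along_direction:
  assumes "smooth_fun L f"
  shows "f (x + s *\<^sub>R g) \<le> f x - s * ((- grad f x) \<bullet> g) + L / 2 * (s * norm g)\<^sup>2"
proof -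
  have "f (x + s *\<^sub>R g) - f x - grad f x \<bullet> (x + s *\<^sub>R g - x)
      \<le> L / 2 * (norm (x + s *\<^sub>R g - x))\<^sup>2"
    using assms unfolding smooth_fun_def by blast
  then show ?thesis by (simp add: power_mult_distrib)
qed

lemma inner_eq_align:
  assumes "e \<noteq> 0"
  shows "d \<bullet> e = align d e * norm d * norm e"
  using assms by (cases "d = 0") (simp_all add: align_def)

text \<open>The step size minimizes the quadratic upper bound given by smoothness.\<close>

lemma smooth_optimal_step:
  assumes smooth: "smooth_fun L f" and "g \<noteq> 0"
    and s: "s = align (- grad f x) g * norm (grad f x) / (L * norm g)"
  shows "f (x + s *\<^sub>R g) \<le> f x - (align (- grad f x) g)\<^sup>2 * (norm (grad f x))\<^sup>2 / (2 * L)"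
proof -
  have L: "0 < L" using smooth by (simp add: smooth_fun_def)
  let ?a = "align (- grad f x) g * norm (grad f x)"
  have sg: "s * norm g = ?a / L" using s \<open>g \<noteq> 0\<close> by simp
  have "s * ((- grad f x) \<bullet> g) = (s * norm g) * ?a"
    using inner_eq_align[OF \<open>g \<noteq> 0\<close>, of "- grad f x"] by simp
  then have "f (x + s *\<^sub>R g) \<le> f x - ?a / L * ?a + L / 2 * (?a / L)\<^sup>2"
    using smooth_along_direction[OF smooth, of x s g] sg by simp
  also have "\<dots> = f x - ?a\<^sup>2 / (2 * L)"
    using L by (simp add: power2_eq_square field_simps)
  finally show ?thesis by (simp add: power_mult_distrib)
qed

lemma short_step_decreasing:
  assumes smooth: "smooth_fun L f" and step: "short_step L f x g \<gamma>"
  shows "f (x + \<gamma> *\<^sub>R g) \<le> f x"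
proof (cases "g = 0")
  case False
  have L: "0 < L" using smooth by (simp add: smooth_fun_def)
  let ?s = "align (- grad f x) g * norm (grad f x) / (L * norm g)"
  show ?thesis
  proof (cases "?s < 1")
    case True
    then have "\<gamma> = ?s" using step by (simp add: short_step_def)
    then have "f (x + \<gamma> *\<^sub>R g) \<le> f x - (align (- grad f x) g)\<^sup>2 * (norm (grad f x))\<^sup>2 / (2 * L)"
      by (rule smooth_optimal_step[OF smooth False])
    also have "\<dots> \<le> f x" using L by simp
    finally show ?thesis .
  next
    case ge: False
    \<comment> \<open>The capped step is shorter than the optimal one, so the quadratic bound still decreases.\<close>
    then have \<gamma>: "\<gamma> = 1" using step by (simp add: short_step_def)
    have "0 < L * norm g" using L False by simp
    then have "L * norm g \<le> align (- grad f x) g * norm (grad f x)"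
      using ge by (simp add: not_less pos_le_divide_eq)
    then have "L * norm g * norm g \<le> align (- grad f x) g * norm (grad f x) * norm g"
      by (rule mult_right_mono) simp
    then have "L * (norm g)\<^sup>2 \<le> (- grad f x) \<bullet> g"
      using inner_eq_align[OF False, of "- grad f x"] by (simp add: power2_eq_square)
    moreover have "0 \<le> L * (norm g)\<^sup>2" using L by simp
    ultimately show ?thesis
      using smooth_along_direction[OF smooth, of x 1 g] \<gamma> by simp
  qed
qed simp

lemma line_search_decreasing:
  assumes "line_search_step f x g \<gamma>"
  shows "f (x + \<gamma> *\<^sub>R g) \<le> f x"
proof -
  have "f (x + \<gamma> *\<^sub>R g) \<le> f (x + 0 *\<^sub>R g)"
    using assms unfolding line_search_step_def is_arg_min_def
    by (metis atLeastAtMost_iff linorder_not_less order_refl zero_le_one)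
  then show ?thesis by simp
qed

text \<open>If a step size \<open>s > 1\<close> were strictly better, convexity would make the step size \<open>1\<close>,
  which lies strictly between \<open>\<gamma>\<close> and \<open>s\<close>, strictly better than \<open>\<gamma>\<close> as well.\<close>

lemma line_search_interior_global:
  assumes cvx: "convex_on UNIV f" and step: "line_search_step f x g \<gamma>"
    and "\<gamma> < 1" "0 \<le> s"
  shows "f (x + \<gamma> *\<^sub>R g) \<le> f (x + s *\<^sub>R g)"
proof -
  have le: "f (x + \<gamma> *\<^sub>R g) \<le> f (x + r *\<^sub>R g)" if "r \<in> {0..1}" for r
    using step that unfolding line_search_step_def is_arg_min_def by (meson linorder_not_less)
  show ?thesis
  proof (cases "s \<le> 1")
    case True
    then show ?thesis using le \<open>0 \<le> s\<close> by simp
  next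
    case False
    define a where "a = (1 - \<gamma>) / (s - \<gamma>)"
    have a: "0 < a" "a \<le> 1" using False \<open>\<gamma> < 1\<close> by (auto simp: a_def)
    have "a * (s - \<gamma>) = 1 - \<gamma>" using False \<open>\<gamma> < 1\<close> by (simp add: a_def)
    then have "(1 - a) * \<gamma> + a * s = 1" by (simp add: algebra_simps)
    moreover have "(1 - a) *\<^sub>R (x + \<gamma> *\<^sub>R g) + a *\<^sub>R (x + s *\<^sub>R g)
        = x + ((1 - a) * \<gamma> + a * s) *\<^sub>R g"
      by (simp add: algebra_simps)
    ultimately have "f (x + 1 *\<^sub>R g) \<le> (1 - a) * f (x + \<gamma> *\<^sub>R g) + a * f (x + s *\<^sub>R g)"
      using convex_onD[OF cvx, of a "x + \<gamma> *\<^sub>R g" "x + s *\<^sub>R g"] a by simp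
    with le[of 1] have "a * f (x + \<gamma> *\<^sub>R g) \<le> a * f (x + s *\<^sub>R g)"
      by (simp add: algebra_simps)
    then show ?thesis using a by simp
  qed
qed

text \<open>Nonnegative alignment makes the optimal step size a point of the half-line over which the
  line search is optimal. It also rules out \<open>g = 0\<close>, whose alignment is \<open>-1\<close>.\<close>

lemma uncapped_step_progress:
  assumes smooth: "smooth_fun L f" and cvx: "convex_on UNIV f"
    and step: "short_step L f x g \<gamma> \<or> line_search_step f x g \<gamma>"
    and "\<gamma> < 1" and al: "0 \<le> align (- grad f x) g"
  shows "f (x + \<gamma> *\<^sub>R g) \<le> f x - (align (- grad f x) g)\<^sup>2 * (norm (grad f x))\<^sup>2 / (2 * L)"
proof -
  have L: "0 < L" using smooth by (simp add: smooth_fun_def)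
  have g: "g \<noteq> 0" using al by (auto simp: align_def)
  let ?s = "align (- grad f x) g * norm (grad f x) / (L * norm g)"
  from step have "f (x + \<gamma> *\<^sub>R g) \<le> f (x + ?s *\<^sub>R g)"
  proof
    assume "short_step L f x g \<gamma>"
    then have "\<gamma> = ?s" using \<open>\<gamma> < 1\<close> by (simp add: short_step_def min_def split: if_splits)
    then show ?thesis by simp
  next
    assume "line_search_step f x g \<gamma>"
    from line_search_interior_global[OF cvx this \<open>\<gamma> < 1\<close>] show ?thesis using L al by simp
  qed
  also note smooth_optimal_step[OF smooth g refl]
  finally show ?thesis .
qed

section \<open>The optimality gap\<close>

lemma gradient_dominated_bdd_below:
  assumes "gradient_dominated \<mu> f"
  shows "bdd_below (f ` S)"
proof -
  obtain z where "is_arg_min f (\<lambda>_. True) z" using assms by (auto simp: gradient_dominated_def)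
  then have "f z \<le> f w" for w by (simp add: is_arg_min_def linorder_not_less)
  then show ?thesis by (auto simp: bdd_below_def)
qed

text \<open>Domination refers to the minimum over the whole space, which is at most the minimum over
  \<open>C\<close>.\<close>

lemma gradient_dominated_gap:
  assumes dom: "gradient_dominated \<mu> f" and "C \<noteq> {}"
  shows "2 * \<mu> * (f x - (INF z\<in>C. f z)) \<le> (norm (grad f x))\<^sup>2"
proof -
  have \<mu>: "0 < \<mu>" using dom by (simp add: gradient_dominated_def)
  have "(INF z. f z) \<le> (INF z\<in>C. f z)"
    using gradient_dominated_bdd_below[OF dom] assms(2) by (intro cINF_superset_mono) auto
  moreover have "f x - (INF z. f z) \<le> (norm (grad f x))\<^sup>2 / (2 * \<mu>)"
    using dom by (simp add: gradient_dominated_def)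
  ultimately have "f x - (INF z\<in>C. f z) \<le> (norm (grad f x))\<^sup>2 / (2 * \<mu>)" by simp
  then show ?thesis using \<mu> by (simp add: field_simps)
qed

text \<open>The linearization of \<open>f\<close> at \<open>y\<close> is a lower bound of \<open>f\<close> by convexity, and at \<open>w\<close> an
  upper bound up to \<open>L / 2 * (norm (w - y))\<^sup>2\<close> by smoothness.\<close>

lemma linear_minimizer_gap:
  fixes f :: "'a::euclidean_space \<Rightarrow> real"
  assumes smooth: "smooth_fun L f" and cvx: "convex_on UNIV f"
    and "bounded C" "y \<in> C" "w \<in> C" and min: "\<And>z. z \<in> C \<Longrightarrow> grad f y \<bullet> w \<le> grad f y \<bullet> z"
  shows "f w - (INF z\<in>C. f z) \<le> L * (diameter C)\<^sup>2 / 2"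
proof -
  have L: "0 < L" using smooth by (simp add: smooth_fun_def)
  have "norm (w - y) \<le> diameter C"
    using diameter_bounded_bound[OF \<open>bounded C\<close> \<open>w \<in> C\<close> \<open>y \<in> C\<close>] by (simp add: dist_norm)
  then have D: "L / 2 * (norm (w - y))\<^sup>2 \<le> L / 2 * (diameter C)\<^sup>2"
    using L by (intro mult_left_mono power_mono) auto
  have "f w - L * (diameter C)\<^sup>2 / 2 \<le> f z" if "z \<in> C" for z
  proof -
    have "f w - f y - grad f y \<bullet> (w - y) \<le> L / 2 * (norm (w - y))\<^sup>2"
      and "f differentiable (at y)"
      using smooth by (auto simp: smooth_fun_def)
    with convex_above_grad_tangent[OF cvx, of y z] min[OF that] D
    show ?thesis by (simp add: inner_diff_right)
  qed
  then have "f w - L * (diameter C)\<^sup>2 / 2 \<le> (INF z\<in>C. f z)"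
    using \<open>y \<in> C\<close> by (intro cINF_greatest) auto
  then show ?thesis by simp
qed

text \<open>Replacing the factor \<open>1 - c\<close> by \<open>exp (- c)\<close> turns the product of the contractions into
  an exponential of their number, and it covers \<open>c > 1\<close>, where \<open>1 - c\<close> is negative.\<close>

lemma counted_contraction:
  fixes h :: "nat \<Rightarrow> real"
  assumes "\<And>t. t < T \<Longrightarrow> 0 \<le> h t" and "h 0 \<le> B"
    and "\<And>t. t < T \<Longrightarrow> h (Suc t) \<le> h t"
    and "\<And>t. t < T \<Longrightarrow> P t \<Longrightarrow> h (Suc t) \<le> (1 - c) * h t"
    and "t \<le> T"
  shows "h t \<le> B * exp (- (c * real (card {s \<in> {0..<t}. P s})))"
  using \<open>t \<le> T\<close>
proof (induction t)
  case 0
  then show ?case using assms(2) by simp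
next
  case (Suc t)
  then have IH: "h t \<le> B * exp (- (c * real (card {s \<in> {0..<t}. P s})))" and t: "t < T" by auto
  have split: "{s \<in> {0..<Suc t}. P s}
      = (if P t then insert t {s \<in> {0..<t}. P s} else {s \<in> {0..<t}. P s})"
    by (auto simp: less_Suc_eq)
  show ?case
  proof (cases "P t")
    case True
    have "h (Suc t) \<le> (1 - c) * h t" using assms(4) t True by blast
    also have "\<dots> \<le> exp (- c) * h t"
      using exp_ge_add_one_self[of "- c"] assms(1)[OF t] by (intro mult_right_mono) auto
    also have "\<dots> \<le> exp (- c) * (B * exp (- (c * real (card {s \<in> {0..<t}. P s}))))"
      using IH by (intro mult_left_mono) auto
    also have "\<dots> = B * exp (- (c * real (card {s \<in> {0..<Suc t}. P s})))"
      using True unfolding split by (simp add: exp_add[symmetric] algebra_simps)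
    finally show ?thesis .
  next
    case False
    then have "{s \<in> {0..<Suc t}. P s} = {s \<in> {0..<t}. P s}" unfolding split by simp
    then show ?thesis using assms(3)[OF t] IH by simp
  qed
qed

section \<open>Convergence rate\<close>

theorem theorem3p4:
  fixes f :: "'a::euclidean_space \<Rightarrow> real" and C :: "'a set" and y :: 'a
    and L \<mu> \<delta> \<omega> p :: real and K T :: nat
    and \<gamma> :: "nat \<Rightarrow> real" and x g :: "nat \<Rightarrow> 'a" and R :: "nat \<Rightarrow> nat"
  assumes "compact C" and "convex C" and "C \<noteq> {}"
    and "smooth_fun L f" and "convex_on UNIV f" and "gradient_dominated \<mu> f"
    and "y \<in> C" and "K \<noteq> 0" and "0 < \<delta>" and "\<delta> < 1"
    and "boostfw_run f C y K \<delta> T \<gamma> x g R"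
    and "\<And>t. t < T \<Longrightarrow> \<not> is_arg_min f (\<lambda>z. z \<in> C) (x t)"
    and "(\<forall>t<T. short_step L f (x t) (g t) (\<gamma> t)) \<or>
         (\<forall>t<T. line_search_step f (x t) (g t) (\<gamma> t))"
    and "0 < \<omega>" and "0 < p" and "p \<le> 1"
    and "\<And>t. t \<le> T \<Longrightarrow>
           real (card {s \<in> {0..<t}. \<gamma> s < 1 \<and> R s > 1}) \<ge> \<omega> * real t powr p"
  shows "\<forall>t\<le>T. f (x t) - (INF z\<in>C. f z)
           \<le> L * (diameter C)\<^sup>2 / 2 * exp (- (\<delta>\<^sup>2 * (\<mu> / L) * \<omega> * real t powr p))"
proof (intro allI impI)
  fix t assume "t \<le> T"
  let ?V = "vertex_set C"
  let ?h = "\<lambda>t. f (x t) - (INF z\<in>C. f z)"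
  let ?B = "L * (diameter C)\<^sup>2 / 2"
  let ?c = "\<delta>\<^sup>2 * (\<mu> / L)"
  have L: "0 < L" and \<mu>: "0 < \<mu>"
    using assms(4,6) by (auto simp: smooth_fun_def gradient_dominated_def)
  have V: "?V \<subseteq> C" using vertex_set_subset[OF assms(1)] .
  have opt: "c \<bullet> z \<le> c \<bullet> v"
    if "is_arg_max (\<lambda>w. c \<bullet> w) (\<lambda>w. w \<in> ?V) v" "z \<in> C" for c v z
    using arg_max_vertex_set_bounds[OF assms(1,2) that] .
  have xSuc: "x (Suc s) = x s + \<gamma> s *\<^sub>R g s" and \<gamma>: "0 \<le> \<gamma> s" "\<gamma> s \<le> 1"
    and loop: "\<exists>d \<Lambda>. boost_loop ?V K \<delta> (x s) (- grad f (x s)) d \<Lambda> (R s) \<and>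
           g s = d (R s) /\<^sub>R \<Lambda> (R s)"
    if "s < T" for s
    using assms(11) that by (auto simp: boostfw_run_def)
  have x0: "is_arg_min (\<lambda>v. grad f y \<bullet> v) (\<lambda>v. v \<in> ?V) (x 0)"
    using assms(11) by (simp add: boostfw_run_def)
  have step: "short_step L f (x s) (g s) (\<gamma> s) \<or> line_search_step f (x s) (g s) (\<gamma> s)"
    if "s < T" for s
    using assms(13) that by blast
  have xC: "x s \<in> C" if "s \<le> T" for s
    using that
  proof (induction s)
    case 0
    then show ?case using x0 V by (auto simp: is_arg_min_def)
  next
    case (Suc s)
    then have s: "s < T" "x s \<in> C" by auto
    have "x s + g s \<in> C"
      using loop[OF s(1)] boost_loop_feasible[OF assms(2) V s(2) opt assms(9)] by metis
    from convexD[OF assms(2) s(2) this, of "1 - \<gamma> s" "\<gamma> s"] \<gamma>[OF s(1)]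
    show ?case unfolding xSuc[OF s(1)] by (simp add: algebra_simps)
  qed
  have nonneg: "0 \<le> ?h s" if "s < T" for s
    using cINF_lower[OF gradient_dominated_bdd_below[OF assms(6)] xC] that by simp
  have start: "?h 0 \<le> ?B"
  proof (rule linear_minimizer_gap[OF assms(4,5) compact_imp_bounded[OF assms(1)] assms(7)])
    show "x 0 \<in> C" using xC by simp
    have "is_arg_max (\<lambda>w. (- grad f y) \<bullet> w) (\<lambda>w. w \<in> ?V) (x 0)"
      using x0 by (simp add: is_arg_min_def is_arg_max_def)
    from opt[OF this] show "grad f y \<bullet> x 0 \<le> grad f y \<bullet> z" if "z \<in> C" for z
      using that by simp
  qed
  have decreasing: "?h (Suc s) \<le> ?h s" if "s < T" for s
    using step[OF that] short_step_decreasing[OF assms(4)] line_search_decreasing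
    unfolding xSuc[OF that] by fastforce
  have contraction: "?h (Suc s) \<le> (1 - ?c) * ?h s" if "s < T" "\<gamma> s < 1 \<and> R s > 1" for s
  proof -
    let ?\<eta> = "align (- grad f (x s)) (g s)"
    have \<eta>: "\<delta> \<le> ?\<eta>"
      using loop[OF that(1)] boost_loop_align[OF assms(2) V xC opt assms(9)] that
      by (metis less_imp_le)
    have "f (x (Suc s)) \<le> f (x s) - ?\<eta>\<^sup>2 * (norm (grad f (x s)))\<^sup>2 / (2 * L)"
      unfolding xSuc[OF that(1)]
      using uncapped_step_progress[OF assms(4,5) step[OF that(1)]] that \<eta> assms(9) by simp
    moreover have "\<delta>\<^sup>2 * (2 * \<mu> * ?h s) \<le> ?\<eta>\<^sup>2 * (norm (grad f (x s)))\<^sup>2"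
      using gradient_dominated_gap[OF assms(6,3), of "x s"] \<eta> assms(9) nonneg[OF that(1)] \<mu>
      by (intro mult_mono power_mono) auto
    then have "\<delta>\<^sup>2 * (2 * \<mu> * ?h s) / (2 * L) \<le> ?\<eta>\<^sup>2 * (norm (grad f (x s)))\<^sup>2 / (2 * L)"
      using L by (intro divide_right_mono) auto
    moreover have "\<delta>\<^sup>2 * (2 * \<mu> * ?h s) / (2 * L) = ?c * ?h s" using L by (simp add: field_simps)
    ultimately show ?thesis by (simp add: algebra_simps)
  qed
  let ?N = "real (card {s \<in> {0..<t}. \<gamma> s < 1 \<and> R s > 1})"
  have "?h t \<le> ?B * exp (- (?c * ?N))"
    by (rule counted_contraction[where h = ?h, OF nonneg start decreasing contraction \<open>t \<le> T\<close>])
  also have "\<dots> \<le> ?B * exp (- (?c * \<omega> * real t powr p))"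
  proof -
    have "?c * (\<omega> * real t powr p) \<le> ?c * ?N"
      using assms(17)[OF \<open>t \<le> T\<close>] L \<mu> by (intro mult_left_mono) auto
    then show ?thesis using L by (intro mult_left_mono) (auto simp: mult.assoc)
  qed
  finally show "?h t \<le> ?B * exp (- (?c * \<omega> * real t powr p))" .
qed

end
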